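(* For each $j\in\{1,\dots,N\}$ let $f_{\tilde V_{N-1}}^{(j)}=\sum_{n=1,\,n\neq j}^N c_n^{N-1}\alpha_n$ be the approximation obtained from $f_{V_N}=\sum_{n=1}^N c_n^N\alpha_n$ by disregarding the coefficient $c_j^N$ and modifying the remaining coefficients as $$c_n^{N-1}=c_n^N-\frac{\langle\beta_n^N,\beta_j^N\rangle}{\|\beta_j^N\|^2}\,c_j^N,\qquad n=1,\dots,j-1,j+1,\dots,N,$$ and let $R_j$ be the residual defined by $f_{V_N}=f_{\tilde V_{N-1}}^{(j)}+R_j$. Then the norm of the residual is minimized by choosing the coefficient to be disregarded as one yielding a minimum value of $|c_j^N|^2/\|\beta_j^N\|^2$; that is, an index $j_0\in\{1,\dots,N\}$ satisfies $\|R_{j_0}\|=\min_{1\le j\le N}\|R_j\|$ if and only if $$\frac{|c_{j_0}^N|^2}{\|\beta_{j_0}^N\|^2}=\min_{1\le j\le N}\frac{|c_j^N|^2}{\|\beta_j^N\|^2}.$$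
   Context: $\mathcal H$ is a (real or complex) Hilbert space with inner product $\langle\cdot,\cdot\rangle$, linear in its second argument (and conjugate-linear in the first in the complex case), and norm $\|\cdot\|$. Let $N\ge 1$ and let $\alpha_1,\dots,\alpha_N\in\mathcal H$ be linearly independent (not necessarily orthogonal) vectors, called atoms, with $V_N=\operatorname{span}\{\alpha_1,\dots,\alpha_N\}$. Let $\beta_1^N,\dots,\beta_N^N\in V_N$ be the dual (biorthogonal) atoms, i.e. the vectors of $V_N$ with $\langle\alpha_n,\beta_m^N\rangle=\delta_{n,m}$ for all $n,m$; they give the orthogonal projector $\hat P_{V_N}$ onto $V_N$ by $\hat P_{V_N}g=\sum_{n=1}^N\alpha_n\langle\beta_n^N,g\rangle$ for $g\in\mathcal H$. Let $f\in\mathcal H$ be a signal, $c_n^N=\langle\beta_n^N,f\rangle$ for $n=1,\dots,N$, and $f_{V_N}=\hat P_{V_N}f=\sum_{n=1}^N c_n^N\alpha_n$. *)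

theory Defs
  imports "HOL-Analysis.Analysis" "Jordan_Normal_Form.Conjugate"
begin

(* The scalars of a real or complex Hilbert space. The norm of a real_normed_field is
   multiplicative, so by Gelfand-Mazur its members are, up to isomorphism, exactly the fields
   of real and of complex numbers; the last axiom then forces the conjugation to be the usual
   one (the identity on the reals). *)
class rc_scalar = real_normed_field + conjugatable_ring +
  assumes mult_conjugate: "x * conjugate x = (norm x)\<^sup>2 *\<^sub>R 1"

instance real :: rc_scalar
  by standard (simp add: power2_eq_square)

instance complex :: rc_scalar
  by standard (simp add: scaleR_conv_of_real complex_norm_square del: of_real_power)

(* Completeness and the real vector space axioms come from the sort banach; norm_sq says that
   the norm is the one induced by the inner product. As ip_conjugate turns additivity and
   homogeneity in the second argument into additivity and conjugate homogeneity in the first,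
   only the former are assumed. *)
locale hilbert_space = vector_space scale
  for scale :: "'k::rc_scalar \<Rightarrow> 'h::banach \<Rightarrow> 'h" +
  fixes ip :: "'h \<Rightarrow> 'h \<Rightarrow> 'k"
  assumes scale_of_real: "scale (of_real r) x = r *\<^sub>R x"
    and ip_conjugate: "conjugate (ip x y) = ip y x"
    and ip_add_right: "ip x (y + z) = ip x y + ip x z"
    and ip_scale_right: "ip x (scale a y) = a * ip x y"
    and norm_sq: "ip x x = of_real ((norm x)\<^sup>2)"
begin

definition independent_family :: "nat \<Rightarrow> (nat \<Rightarrow> 'h) \<Rightarrow> bool" where
  "independent_family N \<alpha> \<longleftrightarrow> inj_on \<alpha> {1..N} \<and> independent (\<alpha> ` {1..N})"

definition dual_atoms :: "nat \<Rightarrow> (nat \<Rightarrow> 'h) \<Rightarrow> (nat \<Rightarrow> 'h) \<Rightarrow> bool" where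
  "dual_atoms N \<alpha> \<beta> \<longleftrightarrow>
     (\<forall>m\<in>{1..N}. \<beta> m \<in> span (\<alpha> ` {1..N})) \<and>
     (\<forall>n\<in>{1..N}. \<forall>m\<in>{1..N}. ip (\<alpha> n) (\<beta> m) = (if n = m then 1 else 0))"

definition coeff :: "(nat \<Rightarrow> 'h) \<Rightarrow> 'h \<Rightarrow> nat \<Rightarrow> 'k" where
  "coeff \<beta> f n = ip (\<beta> n) f"

definition approx :: "nat \<Rightarrow> (nat \<Rightarrow> 'h) \<Rightarrow> (nat \<Rightarrow> 'h) \<Rightarrow> 'h \<Rightarrow> 'h" where
  "approx N \<alpha> \<beta> f = (\<Sum>n=1..N. scale (coeff \<beta> f n) (\<alpha> n))"

definition reduced_coeff :: "(nat \<Rightarrow> 'h) \<Rightarrow> 'h \<Rightarrow> nat \<Rightarrow> nat \<Rightarrow> 'k" where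
  "reduced_coeff \<beta> f j n =
     coeff \<beta> f n - ip (\<beta> n) (\<beta> j) / of_real ((norm (\<beta> j))\<^sup>2) * coeff \<beta> f j"

definition reduced_approx :: "nat \<Rightarrow> (nat \<Rightarrow> 'h) \<Rightarrow> (nat \<Rightarrow> 'h) \<Rightarrow> 'h \<Rightarrow> nat \<Rightarrow> 'h" where
  "reduced_approx N \<alpha> \<beta> f j = (\<Sum>n\<in>{1..N} - {j}. scale (reduced_coeff \<beta> f j n) (\<alpha> n))"

lemma ip_zero_right: "ip x 0 = 0"
  using ip_add_right[of x 0 0] by simp

lemma ip_sum_right: "ip x (\<Sum>i\<in>A. g i) = (\<Sum>i\<in>A. ip x (g i))"
  by (induction A rule: infinite_finite_induct) (simp_all add: ip_zero_right ip_add_right)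

lemma ip_diff_right: "ip x (y - z) = ip x y - ip x z"
  using ip_add_right[of x "y - z" z] by simp

lemma ip_eq_0_commute: "ip x y = 0 \<longleftrightarrow> ip y x = 0"
  by (metis conjugate_zero ip_conjugate)

lemma orthogonal_span:
  assumes "\<And>s. s \<in> S \<Longrightarrow> ip x s = 0" and "v \<in> span S"
  shows "ip x v = 0"
  using assms(2) by (induction rule: span_induct_alt)
    (simp_all add: ip_zero_right ip_add_right ip_scale_right assms(1))

(* The next two lemmas say that approx N \<alpha> \<beta> f is the orthogonal projection of f onto
   the span of the atoms. *)
lemma approx_in_span: "approx N \<alpha> \<beta> f \<in> span (\<alpha> ` {1..N})"
  unfolding approx_def by (intro span_sum span_scale span_base) auto

lemma approx_orthogonal:
  assumes dual: "dual_atoms N \<alpha> \<beta>" and v: "v \<in> span (\<alpha> ` {1..N})"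
  shows "ip v (f - approx N \<alpha> \<beta> f) = 0"
proof -
  let ?V = "span (\<alpha> ` {1..N})"
  define r where "r = f - approx N \<alpha> \<beta> f"
  have \<beta>V: "\<beta> m \<in> ?V" if "m \<in> {1..N}" for m
    using dual that by (auto simp: dual_atoms_def)
  have \<alpha>\<beta>: "ip (\<alpha> n) (\<beta> m) = (if n = m then 1 else 0)"
    if "n \<in> {1..N}" "m \<in> {1..N}" for n m
    using dual that by (auto simp: dual_atoms_def)
  have conjugate_one: "conjugate (1::'k) = 1"
    using mult_conjugate[of "1::'k"] by simp
  have \<beta>\<alpha>: "ip (\<beta> m) (\<alpha> n) = (if n = m then 1 else 0)"
    if "n \<in> {1..N}" "m \<in> {1..N}" for n m
    using \<alpha>\<beta>[OF that] ip_conjugate[of "\<alpha> n" "\<beta> m"] conjugate_one by (auto split: if_splits)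
  have r\<beta>: "ip r (\<beta> m) = 0" if m: "m \<in> {1..N}" for m
  proof -
    have "ip (\<beta> m) (approx N \<alpha> \<beta> f) = (\<Sum>n=1..N. coeff \<beta> f n * ip (\<beta> m) (\<alpha> n))"
      by (simp add: approx_def ip_sum_right ip_scale_right)
    also have "\<dots> = (\<Sum>n=1..N. if n = m then coeff \<beta> f n else 0)"
      by (rule sum.cong[OF refl]) (simp add: \<beta>\<alpha>[OF _ m] del: One_nat_def)
    also have "\<dots> = ip (\<beta> m) f"
      using m by (simp add: coeff_def)
    finally show ?thesis
      by (simp add: r_def ip_diff_right ip_eq_0_commute[of _ "\<beta> m"])
  qed
  define w where "w = v - (\<Sum>m=1..N. scale (ip (\<alpha> m) v) (\<beta> m))"
  have "w \<in> ?V"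
    unfolding w_def using \<beta>V by (intro span_diff span_sum span_scale v) auto
  moreover have "ip w (\<alpha> n) = 0" if n: "n \<in> {1..N}" for n
  proof -
    have "(\<Sum>m=1..N. ip (\<alpha> m) v * ip (\<alpha> n) (\<beta> m)) = (\<Sum>m=1..N. if m = n then ip (\<alpha> m) v else 0)"
      by (rule sum.cong[OF refl]) (simp add: \<alpha>\<beta>[OF n] del: One_nat_def)
    then have "ip (\<alpha> n) w = 0"
      using n by (simp add: w_def ip_diff_right ip_sum_right ip_scale_right)
    then show ?thesis
      by (simp add: ip_eq_0_commute)
  qed
  ultimately have "ip w w = 0"
    using orthogonal_span[of "\<alpha> ` {1..N}" w w] by blast
  then have "v = (\<Sum>m=1..N. scale (ip (\<alpha> m) v) (\<beta> m))"
    by (simp add: norm_sq w_def)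
  moreover have "ip r (\<Sum>m=1..N. scale (ip (\<alpha> m) v) (\<beta> m)) = 0"
    by (simp add: ip_sum_right ip_scale_right r\<beta>)
  ultimately show ?thesis
    unfolding r_def by (metis ip_eq_0_commute)
qed

end

lemma real_hilbert_space:
  "hilbert_space scaleR (inner :: 'a \<Rightarrow> 'a \<Rightarrow> real)"
  for dummy :: "'a::{real_inner, banach}"
  by unfold_locales
    (auto simp: algebra_simps inner_commute inner_add_right power2_norm_eq_inner)

lemma complex_hilbert_space:
  "hilbert_space (*) (\<lambda>x y. cnj x * y)"
proof unfold_locales
  show "cnj x * x = of_real ((norm x)\<^sup>2)" for x
    by (metis complex_norm_square mult.commute)
qed (simp_all add: algebra_simps scaleR_conv_of_real)

end

theory Submission
  imports Defs
begin

text \<open>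
  The dual atom \<open>\<beta>\<^sub>j\<close> lies in the span of the atoms and is orthogonal to every atom but \<open>\<alpha>\<^sub>j\<close>,
  so the atoms other than \<open>\<alpha>\<^sub>j\<close> span the orthogonal complement of \<open>\<beta>\<^sub>j\<close> in that span. The modified
  coefficients are those of the orthogonal projection of \<open>f\<close> onto this complement; hence the
  residual is the component of \<open>f\<close> along \<open>\<beta>\<^sub>j\<close>.

  The coefficients themselves show this. The prescribed modification, applied to \<open>c\<^sub>j\<close> as well,
  turns it into zero, so all coefficients may be treated alike, and the residual is
  \<open>c\<^sub>j / \<parallel>\<beta>\<^sub>j\<parallel>\<^sup>2\<close> times \<open>\<Sum>\<^sub>n \<langle>\<beta>\<^sub>n, \<beta>\<^sub>j\<rangle> \<alpha>\<^sub>n\<close>. That sum is the projection of \<open>\<beta>\<^sub>j\<close> onto the span of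
  the atoms, which is \<open>\<beta>\<^sub>j\<close> itself (\<open>approx_eq_self\<close>, \<open>residual_eq\<close>). Therefore
  \<open>\<parallel>R\<^sub>j\<parallel>\<^sup>2 = \<bar>c\<^sub>j\<bar>\<^sup>2 / \<parallel>\<beta>\<^sub>j\<parallel>\<^sup>2\<close> (\<open>norm_sq_residual\<close>). Squaring preserves the order of norms, so both
  quantities are minimal at the same indices.
\<close>

context hilbert_space
begin

lemma norm_scale: "norm (scale a x) = norm a * norm x"
proof -
  have "of_real ((norm (scale a x))\<^sup>2) = a * conjugate (ip x (scale a x))"
    by (metis ip_conjugate ip_scale_right norm_sq)
  also have "\<dots> = (a * conjugate a) * ip x x"
    by (simp add: ip_scale_right conjugate_dist_mul ip_conjugate mult.assoc)
  also have "\<dots> = of_real ((norm a * norm x)\<^sup>2)"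
    by (simp add: mult_conjugate norm_sq scaleR_conv_of_real power_mult_distrib)
  finally have "(norm (scale a x))\<^sup>2 = (norm a * norm x)\<^sup>2"
    by (simp only: of_real_eq_iff)
  then show ?thesis
    by (rule power2_eq_imp_eq) simp_all
qed

text \<open>
  The error of the projection is orthogonal to the span; for a vector of the span it also lies
  in the span, so it is orthogonal to itself.
\<close>
lemma approx_eq_self:
  assumes "dual_atoms N \<alpha> \<beta>" and "v \<in> span (\<alpha> ` {1..N})"
  shows "approx N \<alpha> \<beta> v = v"
proof -
  have "ip (v - approx N \<alpha> \<beta> v) (v - approx N \<alpha> \<beta> v) = 0"
    using assms by (intro approx_orthogonal span_diff approx_in_span)
  then show ?thesis
    by (simp add: norm_sq)
qed

lemma dual_atom_nonzero:
  assumes "dual_atoms N \<alpha> \<beta>" and "j \<in> {1..N}"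
  shows "\<beta> j \<noteq> 0"
proof
  assume "\<beta> j = 0"
  moreover have "ip (\<alpha> j) (\<beta> j) = 1"
    using assms by (simp add: dual_atoms_def)
  ultimately show False
    by (simp add: ip_zero_right)
qed

lemma residual_eq:
  assumes dual: "dual_atoms N \<alpha> \<beta>" and j: "j \<in> {1..N}"
  shows "approx N \<alpha> \<beta> f - reduced_approx N \<alpha> \<beta> f j =
    scale (coeff \<beta> f j / of_real ((norm (\<beta> j))\<^sup>2)) (\<beta> j)"
proof -
  let ?a = "coeff \<beta> f j / of_real ((norm (\<beta> j))\<^sup>2)"
  have \<beta>j: "\<beta> j \<noteq> 0"
    using dual_atom_nonzero[OF dual j] .
  \<comment> \<open>At \<open>n = j\<close> the correction cancels \<open>c\<^sub>j\<close>, so the omitted atom may be put back into the sum.\<close>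
  have "reduced_coeff \<beta> f j j = 0"
    using \<beta>j by (simp add: reduced_coeff_def norm_sq)
  then have "reduced_approx N \<alpha> \<beta> f j = (\<Sum>n=1..N. scale (reduced_coeff \<beta> f j n) (\<alpha> n))"
    unfolding reduced_approx_def by (intro sum.mono_neutral_left) auto
  then have "approx N \<alpha> \<beta> f - reduced_approx N \<alpha> \<beta> f j =
      (\<Sum>n=1..N. scale (coeff \<beta> f n - reduced_coeff \<beta> f j n) (\<alpha> n))"
    by (simp add: approx_def scale_left_diff_distrib sum_subtractf)
  also have "\<dots> = (\<Sum>n=1..N. scale ?a (scale (coeff \<beta> (\<beta> j) n) (\<alpha> n)))"
    by (simp add: reduced_coeff_def coeff_def mult.commute)
  also have "\<dots> = scale ?a (approx N \<alpha> \<beta> (\<beta> j))"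
    by (simp only: approx_def scale_sum_right)
  also have "approx N \<alpha> \<beta> (\<beta> j) = \<beta> j"
    using dual j by (intro approx_eq_self) (auto simp: dual_atoms_def)
  finally show ?thesis .
qed

lemma norm_sq_residual:
  assumes "dual_atoms N \<alpha> \<beta>" and "j \<in> {1..N}"
  shows "(norm (approx N \<alpha> \<beta> f - reduced_approx N \<alpha> \<beta> f j))\<^sup>2 =
    (norm (coeff \<beta> f j))\<^sup>2 / (norm (\<beta> j))\<^sup>2"
  using dual_atom_nonzero[OF assms]
  by (simp add: residual_eq[OF assms] norm_scale norm_divide norm_mult power2_eq_square divide_simps)

end

lemma eq_Min_image_iff:
  fixes g :: "'a \<Rightarrow> 'b::linorder"
  assumes "finite A" and "a \<in> A"
  shows "g a = (MIN x\<in>A. g x) \<longleftrightarrow> (\<forall>x\<in>A. g a \<le> g x)"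
proof -
  have "g a = (MIN x\<in>A. g x) \<longleftrightarrow> g a \<in> g ` A \<and> (\<forall>y\<in>g ` A. g a \<le> y)"
    using assms by (intro eq_Min_iff) auto
  with assms(2) show ?thesis
    by simp
qed

theorem theorem1:
  fixes scale :: "'k::rc_scalar \<Rightarrow> 'h::banach \<Rightarrow> 'h"
    and ip :: "'h \<Rightarrow> 'h \<Rightarrow> 'k"
    and \<alpha> \<beta> R :: "nat \<Rightarrow> 'h"
    and f :: 'h
    and N j0 :: nat
  assumes "hilbert_space scale ip"
    and "N \<ge> 1"
    and "hilbert_space.independent_family scale N \<alpha>"
    and "hilbert_space.dual_atoms scale ip N \<alpha> \<beta>"
    and "\<And>j. j \<in> {1..N} \<Longrightarrow>
      hilbert_space.approx scale ip N \<alpha> \<beta> f =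
        hilbert_space.reduced_approx scale ip N \<alpha> \<beta> f j + R j"
    and "j0 \<in> {1..N}"
  shows "norm (R j0) = (MIN j\<in>{1..N}. norm (R j)) \<longleftrightarrow>
    (norm (hilbert_space.coeff ip \<beta> f j0))\<^sup>2 / (norm (\<beta> j0))\<^sup>2 =
      (MIN j\<in>{1..N}. (norm (hilbert_space.coeff ip \<beta> f j))\<^sup>2 / (norm (\<beta> j))\<^sup>2)"
proof -
  interpret hilbert_space scale ip
    by fact
  have q: "(norm (coeff \<beta> f j))\<^sup>2 / (norm (\<beta> j))\<^sup>2 = (norm (R j))\<^sup>2" if "j \<in> {1..N}" for j
    using norm_sq_residual[OF assms(4) that, of f] assms(5)[OF that] by simp
  have "norm (R j0) = (MIN j\<in>{1..N}. norm (R j)) \<longleftrightarrow>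
      (\<forall>j\<in>{1..N}. norm (R j0) \<le> norm (R j))"
    using assms(6) by (intro eq_Min_image_iff[of _ _ "\<lambda>j. norm (R j)"]) simp_all
  also have "\<dots> \<longleftrightarrow> (\<forall>j\<in>{1..N}. (norm (R j0))\<^sup>2 \<le> (norm (R j))\<^sup>2)"
    by (simp add: power_mono_iff)
  also have "\<dots> \<longleftrightarrow> (\<forall>j\<in>{1..N}. (norm (coeff \<beta> f j0))\<^sup>2 / (norm (\<beta> j0))\<^sup>2
      \<le> (norm (coeff \<beta> f j))\<^sup>2 / (norm (\<beta> j))\<^sup>2)"
    using assms(6) by (simp add: q del: One_nat_def)
  also have "\<dots> \<longleftrightarrow> (norm (coeff \<beta> f j0))\<^sup>2 / (norm (\<beta> j0))\<^sup>2 =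
      (MIN j\<in>{1..N}. (norm (coeff \<beta> f j))\<^sup>2 / (norm (\<beta> j))\<^sup>2)"
    using assms(6)
    by (intro eq_Min_image_iff[of _ _ "\<lambda>j. (norm (coeff \<beta> f j))\<^sup>2 / (norm (\<beta> j))\<^sup>2", symmetric])
      simp_all
  finally show ?thesis .
qed

end
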